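(* Let $m\geq 1$ and $0\leq r\leq m$, and let $\mathcal{LRM}(r,m)\subseteq \mathbb{Z}_4^{2^{m-1}}$ be the quaternary code defined recursively below. Then $\mathcal{LRM}(r,m)$ is a quaternary linear code (an additive subgroup of $\mathbb{Z}_4^{2^{m-1}}$) of length $n=2^{m-1}$, with $2^k$ codewords where $k=\sum_{i=0}^{r}\binom{m}{i}$, and with minimum Lee distance $d=2^{m-r}$. Moreover, its image $\phi(\mathcal{LRM}(r,m))\subseteq\mathbb{Z}_2^{2^m}$ under the Gray map is a binary code with the parameters of the binary Reed–Muller code $RM(r,m)$ of order $r$, namely length $2^m$, $2^k$ codewords, and minimum Hamming distance $2^{m-r}$.
   Context: The Lee weight on $\mathbb{Z}_4$ is $w_L(0)=0$, $w_L(1)=w_L(3)=1$, $w_L(2)=2$, extended to $\mathbb{Z}_4^n$ by summing over coordinates; the Lee distance is $d_L(x,y)=w_L(x-y)$. The minimum (Lee) distance of a code is the minimum distance between two distinct codewords. Define maps $\beta,\gamma:\mathbb{Z}_4\to\mathbb{Z}_2$ by $\beta(0)=0,\beta(1)=0,\beta(2)=1,\beta(3)=1$ and $\gamma(0)=0,\gamma(1)=1,\gamma(2)=1,\gamma(3)=0$, extended coordinatewise; the Gray map $\phi:\mathbb{Z}_4^n\to\mathbb{Z}_2^{2n}$ is $\phi(x)=(\beta(x),\gamma(x))$. The binary Reed–Muller code $RM(r,m)$ has length $2^m$, $2^{k}$ codewords with $k=\sum_{i=0}^{r}\binom{m}{i}$, and minimum Hamming distance $2^{m-r}$. The codes $\mathcal{LRM}(r,m)$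 are defined as follows. For $m=1$: $\mathcal{LRM}(0,1)=\{(0),(2)\}\subseteq\mathbb{Z}_4$ and $\mathcal{LRM}(1,1)=\mathbb{Z}_4$. For $m\geq 2$ and $0\le r\le m$, by the Plotkin construction $$\mathcal{LRM}(r,m)=\{(x,x+y)\mid x\in\mathcal{LRM}(r,m-1),\ y\in\mathcal{LRM}(r-1,m-1)\},$$ with the conventions $\mathcal{LRM}(-1,m-1)=\{0\}$ (the zero vector of $\mathbb{Z}_4^{2^{m-2}}$) and $\mathcal{LRM}(m,m-1)=\mathbb{Z}_4^{2^{m-2}}$. *)

theory Defs
  imports "HOL-Algebra.Group" "HOL-Library.Numeral_Type"
begin

text \<open>
  Words over an alphabet are lists; the alphabets \<open>\<int>\<^sub>4\<close> and \<open>\<int>\<^sub>2\<close> are the rings of integers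
  modulo 4 and 2 that HOL-Library provides as the types \<^typ>\<open>4\<close> and \<^typ>\<open>2\<close>.
\<close>

definition words :: "nat \<Rightarrow> 'a list set" where
  "words n = {x. length x = n}"

definition word_add :: "'a::plus list \<Rightarrow> 'a list \<Rightarrow> 'a list" where
  "word_add x y = map2 (+) x y"

definition word_diff :: "'a::minus list \<Rightarrow> 'a list \<Rightarrow> 'a list" where
  "word_diff x y = map2 (-) x y"

definition Z4_pow :: "nat \<Rightarrow> 4 list monoid" where
  "Z4_pow n = \<lparr>carrier = words n, mult = word_add, one = replicate n 0\<rparr>"

definition quaternary_linear_code :: "nat \<Rightarrow> 4 list set \<Rightarrow> bool" where
  "quaternary_linear_code n C \<longleftrightarrow> subgroup C (Z4_pow n)"

definition lee_weight1 :: "4 \<Rightarrow> nat" where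
  "lee_weight1 a = (if a = 0 then 0 else if a = 2 then 2 else 1)"

definition lee_weight :: "4 list \<Rightarrow> nat" where
  "lee_weight x = (\<Sum>a\<leftarrow>x. lee_weight1 a)"

definition lee_dist :: "4 list \<Rightarrow> 4 list \<Rightarrow> nat" where
  "lee_dist x y = lee_weight (word_diff x y)"

definition hamming_dist :: "'a list \<Rightarrow> 'a list \<Rightarrow> nat" where
  "hamming_dist x y = card {i. i < length x \<and> x ! i \<noteq> y ! i}"

text \<open>Meaningful only for codes with at least two codewords.\<close>

definition min_dist :: "('a list \<Rightarrow> 'a list \<Rightarrow> nat) \<Rightarrow> 'a list set \<Rightarrow> nat" where
  "min_dist dst C = (LEAST d. \<exists>x\<in>C. \<exists>y\<in>C. x \<noteq> y \<and> dst x y = d)"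

definition has_parameters ::
    "('a list \<Rightarrow> 'a list \<Rightarrow> nat) \<Rightarrow> 'a list set \<Rightarrow> nat \<Rightarrow> nat \<Rightarrow> nat \<Rightarrow> bool" where
  "has_parameters dst C n M d \<longleftrightarrow> C \<subseteq> words n \<and> card C = M \<and> min_dist dst C = d"

definition gray_beta :: "4 \<Rightarrow> 2" where
  "gray_beta a = (if a = 0 \<or> a = 1 then 0 else 1)"

definition gray_gamma :: "4 \<Rightarrow> 2" where
  "gray_gamma a = (if a = 1 \<or> a = 2 then 1 else 0)"

definition gray :: "4 list \<Rightarrow> 2 list" where
  "gray x = map gray_beta x @ map gray_gamma x"

text \<open>
  The order \<open>r\<close> is an integer so that \<open>r = -1\<close> makes sense. The recursion only ever reaches
  \<open>r = -1\<close> and \<open>r = m + 1\<close> outside \<open>0 \<le> r \<le> m\<close>; the conventional values there are used for all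
  \<open>r < 0\<close> and \<open>r > m\<close>. The value at \<open>m = 0\<close> is a dummy.
\<close>

fun LRM :: "int \<Rightarrow> nat \<Rightarrow> 4 list set" where
  "LRM r 0 = {}"
| "LRM r (Suc 0) =
     (if r < 0 then {[0]}
      else if r = 0 then {[0], [2]}
      else words 1)"
| "LRM r (Suc (Suc m)) =
     (if r < 0 then {replicate (2 ^ Suc m) 0}
      else if r > int (Suc (Suc m)) then words (2 ^ Suc m)
      else {x @ word_add x y | x y. x \<in> LRM r (Suc m) \<and> y \<in> LRM (r - 1) (Suc m)})"

text \<open>
  The binary Reed--Muller code: value tables of the Boolean polynomials of degree at most \<open>r\<close> in
  \<open>m\<close> variables. A polynomial is the set \<open>P\<close> of its squarefree monomials, a monomial is the set of
  its variables, and the point with index \<open>j < 2 ^ m\<close> has the binary digits of \<open>j\<close> as coordinates.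
\<close>

definition bool_poly_eval :: "nat set set \<Rightarrow> nat \<Rightarrow> 2" where
  "bool_poly_eval P j = (\<Sum>S\<in>P. \<Prod>i\<in>S. of_bool (bit j i))"

definition RM :: "nat \<Rightarrow> nat \<Rightarrow> 2 list set" where
  "RM r m = {map (bool_poly_eval P) [0..<2 ^ m] | P. P \<subseteq> {S. S \<subseteq> {..<m} \<and> card S \<le> r}}"

lemma UNIV_4: "(UNIV :: 4 set) = {0, 1, 2, 3}"
proof -
  have "card {0, 1, 2, 3 :: 4} = CARD(4)" by simp
  then show ?thesis using card_subset_eq[of "UNIV :: 4 set" "{0, 1, 2, 3}"] by simp
qed

lemma lee_weight1_values:
  "lee_weight1 0 = 0" "lee_weight1 1 = 1" "lee_weight1 2 = 2" "lee_weight1 3 = 1"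
  by (simp_all add: lee_weight1_def)

lemma gray_beta_values:
  "gray_beta 0 = 0" "gray_beta 1 = 0" "gray_beta 2 = 1" "gray_beta 3 = 1"
  by (simp_all add: gray_beta_def)

lemma gray_gamma_values:
  "gray_gamma 0 = 0" "gray_gamma 1 = 1" "gray_gamma 2 = 1" "gray_gamma 3 = 0"
  by (simp_all add: gray_gamma_def)

lemma comm_group_Z4_pow: "comm_group (Z4_pow n)"
proof (rule comm_groupI)
  fix x assume "x \<in> carrier (Z4_pow n)"
  then have "map uminus x \<in> carrier (Z4_pow n) \<and>
      map uminus x \<otimes>\<^bsub>Z4_pow n\<^esub> x = \<one>\<^bsub>Z4_pow n\<^esub>"
    by (auto simp: Z4_pow_def words_def word_add_def intro!: nth_equalityI)
  then show "\<exists>y\<in>carrier (Z4_pow n). y \<otimes>\<^bsub>Z4_pow n\<^esub> x = \<one>\<^bsub>Z4_pow n\<^esub>"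
    by blast
qed (auto simp: Z4_pow_def words_def word_add_def algebra_simps intro!: nth_equalityI)

end

theory Submission
  imports Defs
begin

text \<open>
  Both families of codes satisfy the same Plotkin recursion \<open>A (Suc r) (Suc m) = A (Suc r) m \<^bold>| A r m\<close>,
  where \<open>C \<^bold>| D\<close> consists of the words \<open>(x, x + y)\<close>. This holds even outside \<open>r \<le> m\<close>, where all codes
  are the full space; for \<open>RM\<close> it comes from splitting a polynomial by its last variable. For
  any weight \<open>w\<close> with \<open>w (a - b) \<le> w a + w b\<close>, the word \<open>(x, x + y)\<close> weighs at least \<open>w y\<close>, and it
  weighs \<open>2 w x\<close> if \<open>y = 0\<close>, so the parameters follow by one induction covering the Lee weight on
  \<open>\<int>\<^sub>4\<close> and the Hamming weight on \<open>\<int>\<^sub>2\<close>. The Gray map is an isometry between the two metrics.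
\<close>

section \<open>Additive codes and the Plotkin construction\<close>

text \<open>Closure under differences together with zero is the one-step subgroup criterion; the
  arbitrary alphabet lets it serve both \<open>4\<close> and \<open>2\<close>.\<close>

definition additive_code :: "nat \<Rightarrow> 'a::ab_group_add list set \<Rightarrow> bool" where
  "additive_code n C \<longleftrightarrow> C \<subseteq> words n \<and> replicate n 0 \<in> C \<and> (\<forall>x\<in>C. \<forall>y\<in>C. word_diff x y \<in> C)"

definition plotkin :: "'a::plus list set \<Rightarrow> 'a list set \<Rightarrow> 'a list set" where
  "plotkin C D = {x @ word_add x y | x y. x \<in> C \<and> y \<in> D}"

definition word_weight :: "('a \<Rightarrow> nat) \<Rightarrow> 'a list \<Rightarrow> nat" where
  "word_weight w x = (\<Sum>a\<leftarrow>x. w a)"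

text \<open>A relation rather than a \<open>LEAST\<close>, so that it also asserts the existence of
  a nonzero codeword attaining \<open>d\<close>.\<close>

definition min_weight :: "('a::zero \<Rightarrow> nat) \<Rightarrow> nat \<Rightarrow> 'a list set \<Rightarrow> nat \<Rightarrow> bool" where
  "min_weight w n C d \<longleftrightarrow>
     (\<forall>x\<in>C. x \<noteq> replicate n 0 \<longrightarrow> d \<le> word_weight w x) \<and>
     (\<exists>x\<in>C. x \<noteq> replicate n 0 \<and> word_weight w x = d)"

lemma length_word_add [simp]: "length (word_add x y) = min (length x) (length y)"
  by (simp add: word_add_def)

lemma length_word_diff [simp]: "length (word_diff x y) = min (length x) (length y)"
  by (simp add: word_diff_def)

lemma nth_word_add [simp]:
  "i < length x \<Longrightarrow> i < length y \<Longrightarrow> word_add x y ! i = x ! i + y ! i"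
  by (simp add: word_add_def)

lemma nth_word_diff [simp]:
  "i < length x \<Longrightarrow> i < length y \<Longrightarrow> word_diff x y ! i = x ! i - y ! i"
  by (simp add: word_diff_def)

lemma word_diff_append:
  "length x = length x' \<Longrightarrow> word_diff (x @ y) (x' @ y') = word_diff x x' @ word_diff y y'"
  by (simp add: word_diff_def)

lemma word_diff_word_add:
  fixes x :: "'a::ab_group_add list"
  assumes "length x = n" "length y = n" "length x' = n" "length y' = n"
  shows "word_diff (word_add x y) (word_add x' y') = word_add (word_diff x x') (word_diff y y')"
  using assms by (intro nth_equalityI) (auto simp: algebra_simps)

lemma word_add_zero_right [simp]:
  "length x = n \<Longrightarrow> word_add x (replicate n 0) = (x :: 'a::ab_group_add list)"
  by (intro nth_equalityI) auto

lemma word_add_zero_left [simp]: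
  "length x = n \<Longrightarrow> word_add (replicate n 0) x = (x :: 'a::ab_group_add list)"
  by (intro nth_equalityI) auto

lemma word_diff_zero_right [simp]:
  "length x = n \<Longrightarrow> word_diff x (replicate n 0) = (x :: 'a::ab_group_add list)"
  by (intro nth_equalityI) auto

lemma word_add_diff_cancel:
  "length x = length y \<Longrightarrow> word_diff (word_add x y) x = (y :: 'a::ab_group_add list)"
  by (intro nth_equalityI) auto

lemma word_diff_eq_zero_iff:
  fixes x :: "'a::ab_group_add list"
  assumes "length x = n" "length y = n"
  shows "word_diff x y = replicate n 0 \<longleftrightarrow> x = y"
  using assms by (auto simp: list_eq_iff_nth_eq)

lemma additive_codeD:
  assumes "additive_code n C"
  shows "x \<in> C \<Longrightarrow> length x = n" "replicate n 0 \<in> C"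
    "x \<in> C \<Longrightarrow> y \<in> C \<Longrightarrow> word_diff x y \<in> C"
  using assms by (auto simp: additive_code_def words_def)

lemma additive_code_zero: "additive_code n {replicate n 0 :: 'a::ab_group_add list}"
  by (simp add: additive_code_def words_def)

lemma additive_code_words: "additive_code n (words n :: 'a::ab_group_add list set)"
  by (auto simp: additive_code_def words_def)

text \<open>The map from \<open>(x, y)\<close> to \<open>x @ word_add x y\<close> is additive, so
  differences can be taken in each component.\<close>

lemma additive_code_plotkin:
  assumes C: "additive_code n C" and D: "additive_code n D"
  shows "additive_code (2 * n) (plotkin C D)"
proof -
  have "word_diff (x @ word_add x y) (x' @ word_add x' y') \<in> plotkin C D"
    if "x \<in> C" "x' \<in> C" "y \<in> D" "y' \<in> D" for x x' y y'
  proof -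
    have "word_diff (x @ word_add x y) (x' @ word_add x' y') =
        word_diff x x' @ word_add (word_diff x x') (word_diff y y')"
      using that additive_codeD(1)[OF C] additive_codeD(1)[OF D]
      by (simp add: word_diff_append word_diff_word_add[where n = n])
    then show ?thesis
      using that additive_codeD(3)[OF C] additive_codeD(3)[OF D] unfolding plotkin_def by blast
  qed
  moreover have "replicate (2 * n) 0 \<in> plotkin C D"
    using additive_codeD(2)[OF C] additive_codeD(2)[OF D]
    by (auto simp: plotkin_def mult_2 replicate_add
        intro!: exI[of _ "replicate n 0"])
  moreover have "plotkin C D \<subseteq> words (2 * n)"
    using additive_codeD(1)[OF C] additive_codeD(1)[OF D] by (auto simp: plotkin_def words_def)
  ultimately show ?thesis
    unfolding additive_code_def by (auto simp: plotkin_def)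
qed

text \<open>The pair can be recovered from the word: \<open>x\<close> is the first half and
  \<open>y\<close> is the second half minus the first.\<close>

lemma card_plotkin:
  assumes C: "additive_code n C" and D: "additive_code n D"
  shows "card (plotkin C D) = card C * card D"
proof -
  have "inj_on (\<lambda>(x, y). x @ word_add x y) (C \<times> D)"
  proof (rule inj_onI, clarify)
    fix x y x' y' assume *: "x \<in> C" "y \<in> D" "x' \<in> C" "y' \<in> D"
      and eq: "x @ word_add x y = x' @ word_add x' y'"
    have l: "length x = n" "length x' = n" "length y = n" "length y' = n"
      using * additive_codeD(1)[OF C] additive_codeD(1)[OF D] by auto
    with eq have "x = x'" "word_add x y = word_add x' y'" by auto
    then show "x = x' \<and> y = y'"
      using l by (metis word_add_diff_cancel)
  qed
  moreover have "plotkin C D = (\<lambda>(x, y). x @ word_add x y) ` (C \<times> D)"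
    by (auto simp: plotkin_def)
  ultimately show ?thesis
    by (simp add: card_image card_cartesian_product)
qed

text \<open>Reconciles the full space, prescribed by convention for large orders, with the
  recursion.\<close>

lemma plotkin_words:
  "plotkin (words n) (words n) = (words (2 * n) :: 'a::ab_group_add list set)"
proof (intro equalityI subsetI)
  fix z :: "'a list" assume z: "z \<in> words (2 * n)"
  define x where "x = take n z"
  define y where "y = word_diff (drop n z) x"
  have "x \<in> words n" "y \<in> words n" "z = x @ word_add x y"
    using z by (auto simp: x_def y_def words_def intro!: nth_equalityI simp: nth_append)
  then show "z \<in> plotkin (words n) (words n)"
    by (auto simp: plotkin_def)
qed (auto simp: plotkin_def words_def)

section \<open>Weights, minimum distance and the Plotkin construction\<close>

lemma word_weight_append [simp]: "word_weight w (x @ y) = word_weight w x + word_weight w y"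
  by (simp add: word_weight_def)

text \<open>Differences of codewords are codewords, so no distance falls below the minimum weight;
  the distance from a lightest word to zero attains it.\<close>

lemma min_dist_eq:
  fixes C :: "'a::ab_group_add list set"
  assumes C: "additive_code n C" and min: "min_weight w n C d"
    and dst: "\<And>x y. x \<in> C \<Longrightarrow> y \<in> C \<Longrightarrow> dst x y = word_weight w (word_diff x y)"
  shows "min_dist dst C = d"
  unfolding min_dist_def
proof (rule Least_equality)
  obtain x where x: "x \<in> C" "x \<noteq> replicate n 0" "word_weight w x = d"
    using min by (auto simp: min_weight_def)
  show "\<exists>x\<in>C. \<exists>y\<in>C. x \<noteq> y \<and> dst x y = d"
    using x additive_codeD[OF C] by (intro bexI[of _ x] bexI[of _ "replicate n 0"]) (auto simp: dst)
next
  fix e assume "\<exists>x\<in>C. \<exists>y\<in>C. x \<noteq> y \<and> dst x y = e"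
  then show "d \<le> e"
    using min additive_codeD[OF C] by (auto simp: min_weight_def dst word_diff_eq_zero_iff)
qed

text \<open>The inequality is stated for differences because \<open>y\<close> is the difference of
  the two halves of \<open>(x, x + y)\<close>. With \<open>a = 0\<close> it also yields
  \<open>w (- b) \<le> w b\<close>.\<close>

locale weight =
  fixes w :: "'a::ab_group_add \<Rightarrow> nat"
  assumes weight_zero [simp]: "w 0 = 0"
    and weight_diff: "w (a - b) \<le> w a + w b"
begin

lemma word_weight_diff:
  "length x = length y \<Longrightarrow> word_weight w (word_diff x y) \<le> word_weight w x + word_weight w y"
proof (induction x y rule: list_induct2)
  case (Cons a x b y)
  then show ?case
    using weight_diff[of a b] by (simp add: word_weight_def word_diff_def)
qed (simp add: word_weight_def word_diff_def)

lemma word_weight_zero [simp]: "word_weight w (replicate n 0) = 0"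
  by (simp add: word_weight_def sum_list_replicate)

text \<open>The minimum is the smaller of \<open>2 * c\<close> and the least nonzero weight in
  \<open>D\<close>. Bound and attainment for \<open>D\<close> are separate hypotheses so that
  \<open>D\<close> may be the zero code, which has no nonzero word.\<close>

lemma min_weight_plotkin:
  assumes C: "additive_code n C" and D: "additive_code n D"
    and minC: "min_weight w n C c" and "d \<le> 2 * c"
    and minD: "\<And>y. y \<in> D \<Longrightarrow> y \<noteq> replicate n 0 \<Longrightarrow> d \<le> word_weight w y"
    and attained: "d = 2 * c \<or> (\<exists>y\<in>D. y \<noteq> replicate n 0 \<and> word_weight w y = d)"
  shows "min_weight w (2 * n) (plotkin C D) d"
  unfolding min_weight_def
proof (intro conjI ballI impI)
  fix z assume "z \<in> plotkin C D" and nz: "z \<noteq> replicate (2 * n) 0"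
  then obtain x y where z: "z = x @ word_add x y" and xy: "x \<in> C" "y \<in> D"
    by (auto simp: plotkin_def)
  have len: "length x = n" "length y = n"
    using xy additive_codeD(1)[OF C] additive_codeD(1)[OF D] by auto
  show "d \<le> word_weight w z"
  proof (cases "y = replicate n 0")
    case True
    then have "z = x @ x" using z len by simp
    moreover from this nz have "x \<noteq> replicate n 0"
      by (auto simp: mult_2 replicate_add)
    ultimately show ?thesis
      using minC xy \<open>d \<le> 2 * c\<close> by (force simp: min_weight_def)
  next
    case False
    \<comment> \<open>Here \<open>y\<close> is rewritten as second half minus first half, to which
      the subadditivity of the weight applies.\<close>
    then have "d \<le> word_weight w (word_diff (word_add x y) x)"
      using minD xy len by (simp add: word_add_diff_cancel)
    also have "\<dots> \<le> word_weight w z"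
      using word_weight_diff[of "word_add x y" x] len by (simp add: z)
    finally show ?thesis .
  qed
next
  show "\<exists>z\<in>plotkin C D. z \<noteq> replicate (2 * n) 0 \<and> word_weight w z = d"
    using attained
  proof
    assume d: "d = 2 * c"
    obtain x where x: "x \<in> C" "x \<noteq> replicate n 0" "word_weight w x = c"
      using minC by (auto simp: min_weight_def)
    have len: "length x = n" using x additive_codeD(1)[OF C] by auto
    have "x @ word_add x (replicate n 0) \<in> plotkin C D"
      using x additive_codeD(2)[OF D] unfolding plotkin_def by blast
    then have "x @ x \<in> plotkin C D" using len by simp
    moreover have "x @ x \<noteq> replicate (2 * n) 0"
      using x len by (auto simp: mult_2 replicate_add)
    ultimately show ?thesis
      using d x by (intro bexI[of _ "x @ x"]) auto
  next
    assume "\<exists>y\<in>D. y \<noteq> replicate n 0 \<and> word_weight w y = d"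
    then obtain y where y: "y \<in> D" "y \<noteq> replicate n 0" "word_weight w y = d" by blast
    have len: "length y = n" using y additive_codeD(1)[OF D] by auto
    have "replicate n 0 @ word_add (replicate n 0) y \<in> plotkin C D"
      using y additive_codeD(2)[OF C] unfolding plotkin_def by blast
    then have "replicate n 0 @ y \<in> plotkin C D" using len by simp
    moreover have "replicate n 0 @ y \<noteq> replicate (2 * n) 0"
      using y len by (auto simp: mult_2 replicate_add)
    ultimately show ?thesis
      using y by (intro bexI[of _ "replicate n 0 @ y"]) auto
  qed
qed

section \<open>The common induction for the parameters\<close>

definition RM_like :: "nat \<Rightarrow> nat \<Rightarrow> nat \<Rightarrow> 'a list set \<Rightarrow> bool" where
  "RM_like n r m C \<longleftrightarrow> additive_code n C \<and> card C = 2 ^ (\<Sum>i=0..r. m choose i) \<and>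
     min_weight w n C (2 ^ (m - r))"

text \<open>Pairing with the zero code repeats each word: the size stays and the distance
  doubles.\<close>

lemma RM_like_plotkin_0:
  assumes "RM_like n 0 m C"
  shows "RM_like (2 * n) 0 (Suc m) (plotkin C {replicate n 0})"
  using assms additive_code_zero[of n, where ?'a = 'a]
  unfolding RM_like_def
  by (auto simp: card_plotkin[where n = n] additive_code_plotkin
      intro!: min_weight_plotkin[where c = "2 ^ m"])

text \<open>Pascal's rule summed over \<open>i\<close>: the dimensions add because the cardinalities
  multiply.\<close>

lemma sum_choose_Suc:
  "(\<Sum>i=0..Suc r. Suc m choose i) = (\<Sum>i=0..Suc r. m choose i) + (\<Sum>i=0..r. m choose i)"
  by (induction r) auto

text \<open>The truncated subtraction in the exponent of the distance also covers \<open>r \<ge> m\<close>.\<close>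

lemma RM_like_plotkin_Suc:
  assumes C: "RM_like n (Suc r) m C" and D: "RM_like n r m D"
  shows "RM_like (2 * n) (Suc r) (Suc m) (plotkin C D)"
proof -
  \<comment> \<open>This is an equality for \<open>r < m\<close> and reads \<open>1 \<le> 2\<close>
    otherwise. In both cases the distance is attained by a word of \<open>D\<close>.\<close>
  have "(2::nat) ^ (m - r) \<le> 2 ^ Suc (m - Suc r)"
    by (intro power_increasing) auto
  then have "min_weight w (2 * n) (plotkin C D) (2 ^ (m - r))"
    using C D unfolding RM_like_def
    by (intro min_weight_plotkin[where c = "2 ^ (m - Suc r)"]) (auto simp: min_weight_def)
  then show ?thesis
    using C D unfolding RM_like_def sum_choose_Suc
    by (simp add: additive_code_plotkin card_plotkin[where n = n] power_add)
qed

text \<open>The starting level \<open>l\<close> and the length function \<open>n\<close> are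
  parameters because \<open>LRM\<close> starts at 1 and \<open>RM\<close> at 0. The base covers
  every \<open>r\<close>: order \<open>m + 1\<close> at level \<open>m + 1\<close> already calls for
  order \<open>m + 1\<close> at level \<open>m\<close>.\<close>

lemma RM_like_family:
  assumes base: "\<And>r. RM_like (n l) r l (A r l)"
    and len: "\<And>m. m \<ge> l \<Longrightarrow> n (Suc m) = 2 * n m"
    and zero: "\<And>m. m \<ge> l \<Longrightarrow> A 0 (Suc m) = plotkin (A 0 m) {replicate (n m) 0}"
    and Suc: "\<And>r m. m \<ge> l \<Longrightarrow> A (Suc r) (Suc m) = plotkin (A (Suc r) m) (A r m)"
    and "m \<ge> l"
  shows "RM_like (n m) r m (A r m)"
  using \<open>m \<ge> l\<close>
proof (induction m arbitrary: r rule: dec_induct)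
  case (step m)
  then show ?case
    by (cases r) (auto simp: len zero Suc intro: RM_like_plotkin_0 RM_like_plotkin_Suc)
qed (rule base)

lemma RM_like_has_parameters:
  assumes "RM_like n r m C"
    and "\<And>x y. x \<in> C \<Longrightarrow> y \<in> C \<Longrightarrow> dst x y = word_weight w (word_diff x y)"
  shows "has_parameters dst C n (2 ^ (\<Sum>i=0..r. m choose i)) (2 ^ (m - r))"
  using assms min_dist_eq[of n C w _ dst]
  by (auto simp: has_parameters_def RM_like_def additive_code_def)

end

section \<open>The quaternary codes\<close>

lemma Z4_cases: "P (0::4) \<Longrightarrow> P 1 \<Longrightarrow> P 2 \<Longrightarrow> P 3 \<Longrightarrow> P a"
  using UNIV_4 by (metis UNIV_I empty_iff insert_iff)

lemma Z4_uminus [simp]: "- 1 = (3::4)" "- 2 = (2::4)" "- 3 = (1::4)"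
  by simp_all

interpretation lee: weight lee_weight1
proof
  show "lee_weight1 (a - b) \<le> lee_weight1 a + lee_weight1 b" for a b
    by (rule Z4_cases[of _ a]; rule Z4_cases[of _ b]) (simp_all add: lee_weight1_values)
qed (simp add: lee_weight1_values)

lemma lee_dist_eq: "lee_dist x y = word_weight lee_weight1 (word_diff x y)"
  by (simp add: lee_dist_def lee_weight_def word_weight_def)

text \<open>Inverses arise as \<open>0 - y\<close>, and sums as \<open>x - (- y)\<close>.\<close>

lemma quaternary_linear_codeI:
  assumes C: "additive_code n C"
  shows "quaternary_linear_code n C"
proof -
  interpret comm_group "Z4_pow n" by (rule comm_group_Z4_pow)
  have neg: "map uminus y \<in> C" if "y \<in> C" for y
  proof -
    have "map uminus y = word_diff (replicate n 0) y"
      using that additive_codeD(1)[OF C] by (intro nth_equalityI) auto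
    then show ?thesis using that additive_codeD[OF C] by auto
  qed
  show ?thesis
    unfolding quaternary_linear_code_def
  proof (rule subgroupI)
    show "C \<subseteq> carrier (Z4_pow n)" using C by (auto simp: additive_code_def Z4_pow_def)
    show "C \<noteq> {}" using additive_codeD(2)[OF C] by auto
  next
    fix x assume x: "x \<in> C"
    have "inv\<^bsub>Z4_pow n\<^esub> x = map uminus x"
      using additive_codeD(1)[OF C x]
      by (intro inv_equality) (auto simp: Z4_pow_def words_def intro!: nth_equalityI)
    then show "inv\<^bsub>Z4_pow n\<^esub> x \<in> C" using neg[OF x] by simp
  next
    fix x y assume xy: "x \<in> C" "y \<in> C"
    have "word_add x y = word_diff x (map uminus y)"
      using xy additive_codeD(1)[OF C] by (intro nth_equalityI) auto
    then show "x \<otimes>\<^bsub>Z4_pow n\<^esub> y \<in> C"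
      using xy neg additive_codeD(3)[OF C] by (simp add: Z4_pow_def)
  qed
qed

lemma words_1: "words 1 = (\<lambda>a. [a]) ` UNIV"
  by (auto simp: words_def length_Suc_conv)

lemma LRM_large: "r > int (Suc m) \<Longrightarrow> LRM r (Suc m) = words (2 ^ m)"
  by (cases m) auto

lemma LRM_neg: "r < 0 \<Longrightarrow> LRM r (Suc m) = {replicate (2 ^ m) 0}"
  by (cases m) auto

text \<open>There is no upper bound on \<open>r\<close>: beyond \<open>m + 2\<close> both components
  are full spaces, and \<open>plotkin_words\<close> gives the full space again.\<close>

lemma LRM_Suc:
  assumes "r \<ge> 0"
  shows "LRM r (Suc (Suc m)) = plotkin (LRM r (Suc m)) (LRM (r - 1) (Suc m))"
proof (cases "r > int (Suc (Suc m))")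
  case True
  then show ?thesis
    using plotkin_words[of "2 ^ m", where ?'a = 4] by (simp add: LRM_large del: LRM.simps(2))
qed (use assms in \<open>auto simp: plotkin_def\<close>)

text \<open>Order 0 is the code of 0 and 2, with minimum Lee weight 2. Every higher order is all of
  \<open>words 1\<close>, with four words and minimum weight 1, as \<open>1 choose i\<close>
  vanishes for \<open>i > 1\<close>.\<close>

lemma LRM_base: "lee.RM_like 1 r 1 (LRM (int r) 1)"
proof (cases r)
  case 0
  have "additive_code 1 {[0], [2::4]}"
    by (auto simp: additive_code_def words_def word_diff_def)
  then show ?thesis
    by (auto simp: 0 lee.RM_like_def min_weight_def word_weight_def lee_weight1_values)
next
  case (Suc s)
  have "(\<Sum>i=0..Suc s. 1 choose i) = 2"
    by (induction s) auto
  moreover have "card (words 1 :: 4 list set) = 4"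
    unfolding words_1 by (simp add: card_image inj_on_def)
  moreover have "min_weight lee_weight1 1 (words 1) 1"
    unfolding words_1
    by (auto simp: min_weight_def word_weight_def lee_weight1_def intro!: exI[of _ 1])
  ultimately show ?thesis
    by (simp add: Suc lee.RM_like_def additive_code_words del: sum.atLeast0_atMost_Suc)
qed

lemma RM_like_LRM:
  assumes "m \<ge> 1"
  shows "lee.RM_like (2 ^ (m - 1)) r m (LRM (int r) m)"
proof (rule lee.RM_like_family[where n = "\<lambda>m. 2 ^ (m - 1)" and l = 1 and A = "\<lambda>r. LRM (int r)"])
  show "lee.RM_like (2 ^ (1 - 1)) r 1 (LRM (int r) 1)" for r
    using LRM_base by simp
next
  fix m :: nat assume "1 \<le> m"
  then obtain l where m: "m = Suc l" by (cases m) auto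
  show "2 ^ (Suc m - 1) = 2 * 2 ^ (m - 1)"
    by (simp add: m)
  \<comment> \<open>The second component has order -1 and is the zero code by convention.\<close>
  show "LRM (int 0) (Suc m) = plotkin (LRM (int 0) m) {replicate (2 ^ (m - 1)) 0}"
    using LRM_Suc[of 0 l] LRM_neg[of "-1" l] by (simp add: m del: LRM.simps)
  show "LRM (int (Suc r)) (Suc m) = plotkin (LRM (int (Suc r)) m) (LRM (int r) m)" for r
    using LRM_Suc[of "int (Suc r)" l] by (simp add: m del: LRM.simps)
qed fact

section \<open>The Gray map\<close>

definition hamming_weight1 :: "'a::zero \<Rightarrow> nat" where
  "hamming_weight1 a = (if a = 0 then 0 else 1)"

interpretation hamming: weight hamming_weight1
  by standard (auto simp: hamming_weight1_def)

text \<open>Two symbols differ exactly when their difference is nonzero.\<close>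

lemma hamming_dist_eq:
  assumes "length x = length y"
  shows "hamming_dist x y = word_weight hamming_weight1 (word_diff x (y :: 'a::ab_group_add list))"
proof -
  have "word_weight hamming_weight1 (word_diff x y) =
      (\<Sum>i<length x. if x ! i \<noteq> y ! i then 1 else 0)"
    using assms by (auto simp: word_weight_def sum_list_sum_nth hamming_weight1_def lessThan_atLeast0
        intro!: sum.cong)
  also have "\<dots> = card {i \<in> {..<length x}. x ! i \<noteq> y ! i}"
    by (subst sum.If_cases) (auto intro!: arg_cong[where f = card])
  finally show ?thesis by (simp add: hamming_dist_def)
qed

text \<open>The symbols 0, 1, 2, 3 go to 00, 01, 11, 10, which preserves distances on a 4-cycle. The
  Gray map is not additive, so all sixteen pairs are checked instead of four weights.\<close>

lemma gray_isometry1: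
  "hamming_weight1 (gray_beta a - gray_beta b) + hamming_weight1 (gray_gamma a - gray_gamma b)
   = lee_weight1 (a - b)"
  by (rule Z4_cases[of _ a]; rule Z4_cases[of _ b])
    (simp_all add: lee_weight1_values gray_beta_values gray_gamma_values hamming_weight1_def)

lemma gray_isometry:
  assumes "length x = length y"
  shows "hamming_dist (gray x) (gray y) = lee_dist x y"
proof -
  have "word_weight hamming_weight1 (word_diff (map gray_beta x) (map gray_beta y)) +
      word_weight hamming_weight1 (word_diff (map gray_gamma x) (map gray_gamma y)) =
      word_weight lee_weight1 (word_diff x y)"
    using assms
  proof (induction x y rule: list_induct2)
    case (Cons a x b y)
    then show ?case
      using gray_isometry1[of a b] by (simp add: word_weight_def word_diff_def)
  qed (simp add: word_weight_def word_diff_def)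
  then show ?thesis
    using assms by (simp add: hamming_dist_eq gray_def word_diff_append lee_dist_eq)
qed

text \<open>Symbols with the same Gray image are at Lee distance 0, and only 0 has Lee weight
  0.\<close>

lemma inj_on_gray: "inj_on gray (words n)"
proof (rule inj_onI)
  fix x y :: "4 list" assume "x \<in> words n" "y \<in> words n" and "gray x = gray y"
  then have "length x = length y" "map gray_beta x = map gray_beta y"
    "map gray_gamma x = map gray_gamma y"
    by (auto simp: gray_def words_def)
  then show "x = y"
  proof (induction x y rule: list_induct2)
    case (Cons a x b y)
    then have "lee_weight1 (a - b) = 0"
      using gray_isometry1[of a b] by simp
    with Cons show ?case
      by (simp add: lee_weight1_def split: if_splits)
  qed simp
qed

text \<open>Since \<open>gray\<close> is not additive, the image is not treated through
  \<open>min_weight\<close>. The bijection onto the image preserves the set of distances between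
  distinct codewords, hence its least element.\<close>

lemma has_parameters_gray:
  assumes "has_parameters lee_dist C n M d"
  shows "has_parameters hamming_dist (gray ` C) (2 * n) M d"
proof -
  have C: "C \<subseteq> words n" using assms by (simp add: has_parameters_def)
  have inj: "inj_on gray C" using inj_on_gray C by (rule inj_on_subset)
  have "(\<exists>x\<in>gray ` C. \<exists>y\<in>gray ` C. x \<noteq> y \<and> hamming_dist x y = e) \<longleftrightarrow>
      (\<exists>x\<in>C. \<exists>y\<in>C. x \<noteq> y \<and> lee_dist x y = e)" for e
  proof -
    have "hamming_dist (gray x) (gray y) = lee_dist x y" if "x \<in> C" "y \<in> C" for x y
      using that C by (intro gray_isometry) (auto simp: words_def)
    then show ?thesis using inj by (force simp: inj_on_eq_iff)
  qed
  then have "min_dist hamming_dist (gray ` C) = min_dist lee_dist C"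
    by (simp add: min_dist_def)
  moreover have "gray ` C \<subseteq> words (2 * n)"
    using C by (auto simp: words_def gray_def)
  ultimately show ?thesis
    using assms inj by (simp add: has_parameters_def card_image)
qed

section \<open>The binary Reed--Muller codes\<close>

text \<open>The union stands for \<open>Q + x_m R\<close>. No monomial of \<open>Q\<close> or
  \<open>R\<close> contains \<open>m\<close>, so the union is disjoint and \<open>insert m\<close>
  is injective on \<open>R\<close>.\<close>

lemma bool_poly_eval_split:
  assumes Q: "Q \<subseteq> Pow {..<m}" and R: "R \<subseteq> Pow {..<m}"
  shows "bool_poly_eval (Q \<union> insert m ` R) j =
    bool_poly_eval Q j + of_bool (bit j m) * bool_poly_eval R j"
proof -
  have fin: "finite Q" "finite R"
    using Q R by (auto intro: finite_subset)
  have m: "m \<notin> S \<and> finite S" if "S \<in> Q \<union> R" for S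
    using that Q R by (auto intro: finite_subset)
  have inj: "inj_on (insert m) R"
    using m by (intro inj_onI) (metis UnI2 insert_ident)
  have "bool_poly_eval (Q \<union> insert m ` R) j =
      bool_poly_eval Q j + (\<Sum>S\<in>insert m ` R. \<Prod>i\<in>S. of_bool (bit j i))"
    unfolding bool_poly_eval_def using fin m by (intro sum.union_disjoint) auto
  also have "(\<Sum>S\<in>insert m ` R. \<Prod>i\<in>S. of_bool (bit j i)) =
      of_bool (bit j m) * bool_poly_eval R j"
    unfolding bool_poly_eval_def sum_distrib_left sum.reindex[OF inj] o_def
    using m by (intro sum.cong) auto
  finally show ?thesis .
qed

text \<open>Variables below \<open>m\<close> read only the \<open>m\<close> lowest binary digits,
  which adding \<open>2 ^ m\<close> leaves alone.\<close>

lemma bool_poly_eval_shift: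
  assumes "P \<subseteq> Pow {..<m}"
  shows "bool_poly_eval P (j + 2 ^ m) = bool_poly_eval P j"
proof -
  have "bit (j + 2 ^ m) i = bit j i" if "i < m" for i
  proof -
    have "bit (take_bit m (j + 2 ^ m)) i = bit (take_bit m j) i"
      by (simp add: take_bit_eq_mod)
    then show ?thesis using that by (simp add: bit_take_bit_iff)
  qed
  then show ?thesis
    unfolding bool_poly_eval_def using assms by (intro sum.cong prod.cong) auto
qed

definition value_table :: "nat \<Rightarrow> nat set set \<Rightarrow> 2 list" where
  "value_table m P = map (bool_poly_eval P) [0..<2 ^ m]"

lemma length_value_table [simp]: "length (value_table m P) = 2 ^ m"
  by (simp add: value_table_def)

lemma RM_eq: "RM r m = {value_table m P | P. P \<subseteq> {S. S \<subseteq> {..<m} \<and> card S \<le> r}}"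
  by (simp add: RM_def value_table_def)

text \<open>The last variable is the leading digit of the index: it is 0 on the first half, leaving
  \<open>Q\<close>, and 1 on the second, giving \<open>Q + R\<close>.\<close>

lemma value_table_split:
  assumes Q: "Q \<subseteq> Pow {..<m}" and R: "R \<subseteq> Pow {..<m}"
  shows "value_table (Suc m) (Q \<union> insert m ` R) =
    value_table m Q @ word_add (value_table m Q) (value_table m R)"
proof (rule nth_equalityI)
  fix j assume "j < length (value_table (Suc m) (Q \<union> insert m ` R))"
  then have j: "j < 2 ^ Suc m" by simp
  note eval = bool_poly_eval_split[OF Q R]
  show "value_table (Suc m) (Q \<union> insert m ` R) ! j =
    (value_table m Q @ word_add (value_table m Q) (value_table m R)) ! j"
  proof (cases "j < 2 ^ m")
    case True
    then have "\<not> bit j m" by (simp add: bit_iff_odd)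
    then show ?thesis using True j by (simp add: value_table_def nth_append eval)
  next
    case False
    define l where "l = j - 2 ^ m"
    have l: "j = l + 2 ^ m" "l < 2 ^ m" using False j by (auto simp: l_def)
    then have "bit j m" by (simp add: bit_iff_odd div_add_self2)
    then show ?thesis
      using l j by (simp add: value_table_def nth_append eval bool_poly_eval_shift[OF Q]
          bool_poly_eval_shift[OF R])
  qed
qed simp

text \<open>The polynomials \<open>Q\<close> and \<open>R\<close> in \<open>P = Q + x\<^sub>m R\<close> for \<open>P\<close> of degree at most \<open>r\<close>.\<close>

lemma monomials_split:
  assumes P: "P \<subseteq> {S. S \<subseteq> {..<Suc m} \<and> card S \<le> r}"
  obtains Q R where "P = Q \<union> insert m ` R"
    "Q \<subseteq> {S. S \<subseteq> {..<m} \<and> card S \<le> r}" "R \<subseteq> {S. S \<subseteq> {..<m} \<and> card S < r}"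
proof
  \<comment> \<open>The monomials divisible by the last variable, each divided by it.\<close>
  let ?R = "(\<lambda>S. S - {m}) ` {S \<in> P. m \<in> S}"
  have "insert m ` ?R = {S \<in> P. m \<in> S}"
    by (force simp: image_image insert_absorb)
  then show "P = {S \<in> P. m \<notin> S} \<union> insert m ` ?R" by auto
  show "{S \<in> P. m \<notin> S} \<subseteq> {S. S \<subseteq> {..<m} \<and> card S \<le> r}"
    using P by (force simp: lessThan_Suc)
  show "?R \<subseteq> {S. S \<subseteq> {..<m} \<and> card S < r}"
  proof clarify
    fix S assume S: "S \<in> P" "m \<in> S"
    then have "S \<subseteq> {..<Suc m}" "card S \<le> r" using P by auto
    moreover from this have "card (S - {m}) < card S"
      using S by (intro card_Diff1_less) (auto intro: finite_subset)
    ultimately show "S - {m} \<subseteq> {..<m} \<and> card (S - {m}) < r"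
      by (auto simp: lessThan_Suc)
  qed
qed

text \<open>The strict degree bound treats all orders at once: for \<open>r = 0\<close> only the
  empty polynomial remains, and for a successor it describes the code of the preceding
  order.\<close>

lemma RM_Suc_eq_plotkin:
  "RM r (Suc m) = plotkin (RM r m) {value_table m R | R. R \<subseteq> {S. S \<subseteq> {..<m} \<and> card S < r}}"
  (is "_ = plotkin _ ?D")
proof (intro equalityI subsetI)
  fix z assume "z \<in> RM r (Suc m)"
  then obtain P where z: "z = value_table (Suc m) P"
    and P: "P \<subseteq> {S. S \<subseteq> {..<Suc m} \<and> card S \<le> r}"
    by (auto simp: RM_eq)
  obtain Q R where QR: "P = Q \<union> insert m ` R"
    "Q \<subseteq> {S. S \<subseteq> {..<m} \<and> card S \<le> r}" "R \<subseteq> {S. S \<subseteq> {..<m} \<and> card S < r}"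
    using P by (rule monomials_split)
  have "z = value_table m Q @ word_add (value_table m Q) (value_table m R)"
    unfolding z QR(1) using QR by (intro value_table_split) auto
  then show "z \<in> plotkin (RM r m) ?D"
    using QR unfolding plotkin_def RM_eq by blast
next
  fix z assume "z \<in> plotkin (RM r m) ?D"
  then obtain Q R where QR: "Q \<subseteq> {S. S \<subseteq> {..<m} \<and> card S \<le> r}"
    "R \<subseteq> {S. S \<subseteq> {..<m} \<and> card S < r}"
    and z: "z = value_table m Q @ word_add (value_table m Q) (value_table m R)"
    unfolding plotkin_def RM_eq by blast
  have "z = value_table (Suc m) (Q \<union> insert m ` R)"
    unfolding z using QR by (intro value_table_split[symmetric]) auto
  moreover have "card (insert m S) \<le> r" if "S \<in> R" for S
    using that QR(2) card_insert_le_m1[of r S m] by fastforce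
  then have "Q \<union> insert m ` R \<subseteq> {S. S \<subseteq> {..<Suc m} \<and> card S \<le> r}"
    using QR by (auto simp: lessThan_Suc)
  ultimately show "z \<in> RM r (Suc m)"
    unfolding RM_eq by blast
qed

text \<open>Without variables the only monomial is the constant 1, so both words of length 1 occur
  for every order.\<close>

lemma RM_base: "hamming.RM_like 1 r 0 (RM r 0)"
proof -
  have "{S :: nat set. S \<subseteq> {..<0} \<and> card S \<le> r} = {{}}" by auto
  then have "RM r 0 = (\<lambda>P. map (bool_poly_eval P) [0..<2 ^ 0]) ` Pow {{}}"
    unfolding RM_def by auto
  also have "\<dots> = {[0], [1]}"
    by (simp add: bool_poly_eval_def Pow_insert insert_commute)
  finally have RM: "RM r 0 = {[0], [1]}" .
  have "(\<Sum>i=0..r. 0 choose i) = (1::nat)"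
    by (induction r) auto
  moreover have "additive_code 1 {[0], [1::2]}"
    by (simp add: additive_code_def words_def word_diff_def)
  moreover have "card {[0], [1::2]} = 2"
    by simp
  moreover have "min_weight hamming_weight1 1 {[0], [1::2]} 1"
    by (simp add: min_weight_def word_weight_def hamming_weight1_def)
  ultimately show ?thesis
    by (simp only: RM hamming.RM_like_def) simp
qed

lemma RM_like_RM: "hamming.RM_like (2 ^ m) r m (RM r m)"
proof (rule hamming.RM_like_family[where n = "\<lambda>m. 2 ^ m" and l = 0 and A = RM])
  show "hamming.RM_like (2 ^ 0) r 0 (RM r 0)" for r
    using RM_base by simp
  have "value_table m {} = replicate (2 ^ m) 0" for m
    by (intro nth_equalityI) (auto simp: value_table_def bool_poly_eval_def)
  then show "RM 0 (Suc m) = plotkin (RM 0 m) {replicate (2 ^ m) 0}" for m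
    by (simp add: RM_Suc_eq_plotkin)
  show "RM (Suc r) (Suc m) = plotkin (RM (Suc r) m) (RM r m)" for r m
    by (simp add: RM_Suc_eq_plotkin RM_eq[of r m] less_Suc_eq_le)
qed auto

theorem theorem1:
  fixes m r k :: nat
  assumes "m \<ge> 1" and "r \<le> m"
    and "k = (\<Sum>i=0..r. m choose i)"
  shows "quaternary_linear_code (2 ^ (m - 1)) (LRM (int r) m) \<and>
         has_parameters lee_dist (LRM (int r) m) (2 ^ (m - 1)) (2 ^ k) (2 ^ (m - r)) \<and>
         has_parameters hamming_dist (gray ` LRM (int r) m) (2 ^ m) (2 ^ k) (2 ^ (m - r)) \<and>
         has_parameters hamming_dist (RM r m) (2 ^ m) (2 ^ k) (2 ^ (m - r))"
proof (intro conjI)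
  note LRM = RM_like_LRM[OF \<open>m \<ge> 1\<close>, of r]
  show "quaternary_linear_code (2 ^ (m - 1)) (LRM (int r) m)"
    using LRM by (intro quaternary_linear_codeI) (simp add: lee.RM_like_def)
  show lee: "has_parameters lee_dist (LRM (int r) m) (2 ^ (m - 1)) (2 ^ k) (2 ^ (m - r))"
    unfolding assms(3) using LRM by (rule lee.RM_like_has_parameters) (rule lee_dist_eq)
  have "2 * 2 ^ (m - 1) = (2 ^ m :: nat)"
    using \<open>m \<ge> 1\<close> by (cases m) auto
  then show "has_parameters hamming_dist (gray ` LRM (int r) m) (2 ^ m) (2 ^ k) (2 ^ (m - r))"
    using has_parameters_gray[OF lee] by simp
  \<comment> \<open>The parameters are derived for \<open>RM\<close> from its polynomial definition,
    so the comparison with the Gray image is itself proved.\<close>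
  show "has_parameters hamming_dist (RM r m) (2 ^ m) (2 ^ k) (2 ^ (m - r))"
    unfolding assms(3) using RM_like_RM
    by (rule hamming.RM_like_has_parameters) (auto simp: RM_eq intro: hamming_dist_eq)
qed

end
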